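(* Let $f: \mathbb{N} \to [0,\infty)$ be a non-increasing function satisfying \[ \lim_{q \to \infty} f(q) = 0, \qquad \sum_{q=1}^\infty f(q) = \infty. \] Then there exists $\psi: \mathbb{N} \to [0,\infty)$, non-increasing on its support, such that \[ \psi \leqslant f, \qquad \sum_{q \in \mathbb{N}} \psi(q) = \infty, \qquad \lambda(W(\psi)) = 0, \qquad \bar\delta(\operatorname{supp} \psi) = 1. \]
   Context: $\mathbb{N}$ denotes the positive integers and $\lambda$ denotes Lebesgue measure on $\mathbb{R}$. For $x \in \mathbb{R}$, $\|x\| = \min\{|x-a| : a \in \mathbb{Z}\}$. For $\psi: \mathbb{N} \to [0,\infty)$, \[ W(\psi) = \{\alpha \in [0,1] : \|q\alpha\| < \psi(q) \text{ for infinitely many } q \in \mathbb{N}\}, \] and $\operatorname{supp}\psi = \{q \in \mathbb{N} : \psi(q) \neq 0\}$. "Non-increasing on its support" means that $\psi(q) \geqslant \psi(q')$ whenever $q \leqslant q'$ both lie in $\operatorname{supp}\psi$. The upper density of $S \subseteq \mathbb{N}$ is \[ \bar\delta(S) = \limsup_{N \to \infty} \frac{|S \cap [1,N]|}{N}. \] *)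

theory Defs
  imports "HOL-Analysis.Analysis"
begin

text \<open>
  The positive integers are the subset \<open>{1..}\<close> of \<^typ>\<open>nat\<close>: a function on them is a function
  on \<^typ>\<open>nat\<close> whose value at \<open>0\<close> is never inspected.
\<close>

definition nearest_int_dist :: "real \<Rightarrow> real" where
  "nearest_int_dist x = (INF a::int. \<bar>x - of_int a\<bar>)"

text \<open>The infimum is attained, so it is the minimum.\<close>

lemma nearest_int_dist_eq_round: "nearest_int_dist x = \<bar>x - of_int (round x)\<bar>"
  unfolding nearest_int_dist_def
proof (rule cInf_eq_minimum)
  show "\<bar>x - of_int (round x)\<bar> \<le> y" if "y \<in> range (\<lambda>a::int. \<bar>x - of_int a\<bar>)" for y
    using that round_diff_minimal[of x] by (auto simp: abs_minus_commute)
qed auto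

definition W :: "(nat \<Rightarrow> real) \<Rightarrow> real set" where
  "W \<psi> = {\<alpha> \<in> {0..1}. infinite {q \<in> {1..}. nearest_int_dist (real q * \<alpha>) < \<psi> q}}"

definition supp :: "(nat \<Rightarrow> real) \<Rightarrow> nat set" where
  "supp \<psi> = {q \<in> {1..}. \<psi> q \<noteq> 0}"

definition upper_density :: "nat set \<Rightarrow> ereal" where
  "upper_density S = limsup (\<lambda>N. ereal (real (card (S \<inter> {1..N})) / real N))"

text \<open>Meant for nonnegative \<open>f\<close>, where the order of summation is immaterial.\<close>

definition sum_diverges :: "(nat \<Rightarrow> real) \<Rightarrow> bool" where
  "sum_diverges f \<longleftrightarrow> filterlim (\<lambda>N. \<Sum>q=1..N. f q) at_top sequentially"

end

theory Submission
  imports Defs "HOL-Computational_Algebra.Primes" "HOL-Real_Asymp.Real_Asymp"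
begin

text \<open>
  The Borel--Cantelli lemma reduces the construction to finite pieces: it suffices to find,
  arbitrarily far out and below any prescribed bound, functions of finite support that lie below \<open>f\<close>,
  are non-increasing on their support and have mass at least \<open>1\<close>, but for which the set of \<open>\<alpha>\<close> with
  \<open>\<parallel>q\<alpha>\<parallel> < \<psi>(q)\<close> for at least one \<open>q\<close> has measure at most \<open>\<epsilon>\<close>. Upper density \<open>1\<close> is then obtained by
  appending to each piece a very long stretch on which the function is a minute constant; this
  stretch has negligible total mass (lemma \<open>exists_dense_block\<close>).
  
  Since \<open>f\<close> may decay almost as fast as a summable function, a sparse support would carry too little
  mass. Each piece is therefore supported on a periodic set \<open>S\<close>, chosen for its \<open>\<epsilon>\<close>, and is constant on \<open>S\<close> in each dyadic range \<open>[X, 2 * X)\<close>. If the constant is \<open>d\<close>, the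
  approximated set lies within \<open>d / X\<close> of the fractions \<open>a / q\<close> with \<open>q\<close> in \<open>S\<close> and in this range, so its
  measure is small compared with the mass \<open>d * card (S \<inter> [X, 2 * X))\<close> as soon as these fractions
  coincide so often that only a small proportion of the pairs \<open>(a, q)\<close> gives distinct values.
  
  Such an \<open>S\<close> consists of the integers that are divisible by all but at most \<open>M\<close> primes in each dyadic
  range below \<open>2 ^ I\<close> (lemma \<open>exists_set_with_few_fractions\<close>). As the prime reciprocals have a divergent
  sum, for most pairs \<open>(a, q)\<close> some prime \<open>p\<close> of a range with at least \<open>M\<close> primes divides both \<open>a\<close> and \<open>q\<close>. Replacing \<open>p\<close> in
  \<open>a\<close> and \<open>q\<close> by another prime of the same range does not change \<open>a / q\<close>, changes the denominator by
  a factor less than \<open>2\<close>, and for at least \<open>M\<close> choices of the new prime keeps the denominator in \<open>S\<close> (lemma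
  \<open>rich_swap\<close>). Hence most fractions have at least \<open>M\<close> representations, and \<open>M\<close> is large.
  The condensation test shows that the masses of the dyadic ranges have a divergent sum, so finitely
  many ranges provide mass \<open>1\<close> (lemma \<open>exists_heavy_block\<close>).
\<close>

section \<open>Divergence of the sum of prime reciprocals\<close>

text \<open>
  One inequality in Euler's product: the reciprocals of the integers composed of primes in \<open>P\<close> sum
  to at most the product of the factors \<open>1 / (1 - 1 / p)\<close>. Truncating at \<open>N\<close> keeps all sums finite.
\<close>

lemma sum_reciprocals_smooth_le:
  fixes P :: "nat set"
  assumes "finite P" "\<forall>p\<in>P. prime p"
  shows "(\<Sum>n | n \<in> {1..N} \<and> (\<forall>p. prime p \<and> p dvd n \<longrightarrow> p \<in> P). 1 / real n)
           \<le> (\<Prod>p\<in>P. 1 / (1 - 1 / real p))"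
  using assms
proof (induction P rule: finite_induct)
  case empty
  have "{n \<in> {1..N}. \<forall>p. prime p \<and> p dvd n \<longrightarrow> p \<in> {}} \<subseteq> {1::nat}"
    using prime_factor_nat by auto
  then have "(\<Sum>n | n \<in> {1..N} \<and> (\<forall>p. prime p \<and> p dvd n \<longrightarrow> p \<in> {}). 1 / real n)
               \<le> (\<Sum>n\<in>{1::nat}. 1 / real n)"
    by (intro sum_mono2) auto
  then show ?case by simp
next
  case (insert p P)
  define Sm where "Sm P = {n \<in> {1..N}. \<forall>p. prime p \<and> p dvd n \<longrightarrow> p \<in> P}" for P :: "nat set"
  define D where "D = {n \<in> Sm (insert p P). p dvd n}"
  have p: "prime p" "p > 1" using insert.prems prime_gt_1_nat by auto
  have fin: "finite (Sm P)" for P by (simp add: Sm_def)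
  \<comment> \<open>The members divisible by \<open>p\<close> are \<open>p\<close> times smaller members, so their sum is at most \<open>1 / p\<close> of the whole.\<close>
  have split: "Sm (insert p P) \<subseteq> Sm P \<union> D"
    by (auto simp: Sm_def D_def)
  have D: "(\<Sum>n\<in>D. 1 / real n) \<le> 1 / real p * (\<Sum>n\<in>Sm (insert p P). 1 / real n)"
  proof -
    have sub: "D \<subseteq> (*) p ` Sm (insert p P)"
    proof
      fix n assume n: "n \<in> D"
      then obtain m where m: "n = p * m" by (auto simp: D_def)
      have "1 \<le> m" using n m by (auto simp: D_def Sm_def intro: Suc_leI)
      moreover have "m \<le> n" using m p by simp
      moreover have "n \<le> N" using n by (simp add: D_def Sm_def)
      ultimately have "m \<in> {1..N}" by simp
      then have "m \<in> Sm (insert p P)"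
        using n dvd_mult[of _ m p] unfolding D_def Sm_def m by simp
      then show "n \<in> (*) p ` Sm (insert p P)" using m by auto
    qed
    have "(\<Sum>n\<in>D. 1 / real n) \<le> (\<Sum>n\<in>(*) p ` Sm (insert p P). 1 / real n)"
      by (intro sum_mono2 sub) (auto simp: fin)
    also have "\<dots> = (\<Sum>n\<in>Sm (insert p P). 1 / real p * (1 / real n))"
      using p by (subst sum.reindex) (auto simp: inj_on_def)
    finally show ?thesis by (simp only: sum_distrib_left)
  qed
  have "(\<Sum>n\<in>Sm (insert p P). 1 / real n) \<le> (\<Sum>n\<in>Sm P \<union> D. 1 / real n)"
    by (intro sum_mono2 split) (auto simp: fin D_def)
  also have "\<dots> \<le> (\<Sum>n\<in>Sm P. 1 / real n) + (\<Sum>n\<in>D. 1 / real n)"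
    using sum.union_inter[of "Sm P" D "\<lambda>n. 1 / real n"] fin
      sum_nonneg[of "Sm P \<inter> D" "\<lambda>n. 1 / real n"] by (simp add: D_def)
  finally have "(\<Sum>n\<in>Sm (insert p P). 1 / real n) * (1 - 1 / real p) \<le> (\<Sum>n\<in>Sm P. 1 / real n)"
    using D by (simp add: algebra_simps)
  moreover have "(\<Sum>n\<in>Sm P. 1 / real n) \<le> (\<Prod>p\<in>P. 1 / (1 - 1 / real p))"
    using insert unfolding Sm_def by simp
  ultimately have "(\<Sum>n\<in>Sm (insert p P). 1 / real n) * (1 - 1 / real p) \<le> (\<Prod>p\<in>P. 1 / (1 - 1 / real p))"
    by linarith
  then have "(\<Sum>n\<in>Sm (insert p P). 1 / real n) \<le> (\<Prod>p\<in>P. 1 / (1 - 1 / real p)) / (1 - 1 / real p)"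
    using p by (subst pos_le_divide_eq) auto
  then show ?case using insert unfolding Sm_def by (simp add: mult.commute)
qed

lemma ln_le_sum_prime_reciprocals:
  "ln (ln (real N + 1)) \<le> 2 * (\<Sum>p | prime p \<and> p \<le> N. 1 / real p)" if "N \<ge> 1"
proof -
  define P where "P = {p. prime p \<and> p \<le> N}"
  have finP: "finite P" unfolding P_def by (rule finite_subset[of _ "{..N}"]) auto
  have eq: "{n. n \<in> {1..N} \<and> (\<forall>p. prime p \<and> p dvd n \<longrightarrow> p \<in> P)} = {1..N}"
    by (auto simp: P_def dest: dvd_imp_le)
  have "ln (real N + 1) \<le> harm N" by (rule ln_le_harm)
  also have "\<dots> = (\<Sum>n=1..N. 1 / real n)" by (simp add: harm_def inverse_eq_divide)
  also have "\<dots> \<le> (\<Prod>p\<in>P. 1 / (1 - 1 / real p))"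
  proof -
    have "\<forall>p\<in>P. prime p" by (simp add: P_def)
    from sum_reciprocals_smooth_le[OF finP this, of N] show ?thesis unfolding eq .
  qed
  also have "\<dots> \<le> (\<Prod>p\<in>P. exp (2 / real p))"
  proof (rule prod_mono)
    fix p assume "p \<in> P"
    then have p: "p \<ge> 2" by (auto simp: P_def intro: prime_ge_2_nat)
    then have "1 / (1 - 1 / real p) \<le> 1 + 2 / real p"
      by (simp add: field_simps)
    also have "\<dots> \<le> exp (2 / real p)" by (rule exp_ge_add_one_self)
    finally show "0 \<le> 1 / (1 - 1 / real p) \<and> 1 / (1 - 1 / real p) \<le> exp (2 / real p)"
      using p by (auto simp: field_simps)
  qed
  also have "\<dots> = exp (2 * (\<Sum>p\<in>P. 1 / real p))"
    using finP by (simp add: exp_sum sum_distrib_left)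
  finally have "ln (ln (real N + 1)) \<le> ln (exp (2 * (\<Sum>p\<in>P. 1 / real p)))"
    using that by (subst ln_le_cancel_iff) auto
  then show ?thesis by (simp add: P_def)
qed

section \<open>Numerators avoiding a set of primes\<close>

text \<open>
  The induction removes from the integers counted for \<open>P\<close> the multiples of a new prime \<open>p\<close>; these are
  \<open>p\<close> times the integers counted for \<open>P\<close> up to \<open>q div p\<close>.
\<close>

lemma card_coprime_to_primes:
  fixes P :: "nat set"
  assumes "finite P" "\<forall>p\<in>P. prime p \<and> p dvd q" "q \<ge> 1"
  shows "real (card {a \<in> {1..q}. \<forall>p\<in>P. \<not> p dvd a}) = real q * (\<Prod>p\<in>P. 1 - 1 / real p)"
  using assms
proof (induction P arbitrary: q rule: finite_induct)
  case empty
  have "{a \<in> {1..q}. \<forall>p\<in>{}. \<not> p dvd a} = {1..q}" by auto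
  then show ?case by simp
next
  case (insert p P)
  define C where "C q = {a \<in> {1..q}. \<forall>p\<in>P. \<not> p dvd a}" for q
  have p: "prime p" "p dvd q" using insert.prems by simp_all
  then have p1: "p > 1" using prime_gt_1_nat by blast
  obtain r where r: "q = p * r" using p by (auto elim: dvdE)
  have r1: "r \<ge> 1" using insert.prems r by (cases r) auto
  have ndvd: "\<not> p' dvd p" if "p' \<in> P" for p'
  proof
    assume "p' dvd p"
    moreover have "prime p'" using that insert.prems by simp
    ultimately show False using p(1) primes_dvd_imp_eq[of p' p] that insert.hyps by simp
  qed
  have Pr: "\<forall>p'\<in>P. prime p' \<and> p' dvd r"
  proof
    fix p' assume p': "p' \<in> P"
    then have "prime p'" "p' dvd p * r" using insert.prems r by simp_all
    then show "prime p' \<and> p' dvd r" using ndvd[OF p'] by (simp add: prime_dvd_mult_iff)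
  qed
  have eq: "{a \<in> {1..q}. \<forall>p\<in>insert p P. \<not> p dvd a} = C q - (*) p ` C r"
  proof (intro equalityI subsetI)
    fix a assume a: "a \<in> C q - (*) p ` C r"
    have "\<not> p dvd a"
    proof
      assume "p dvd a"
      then obtain b where b: "a = p * b" by auto
      then have "b \<in> C r" using a p1 r by (auto simp: C_def Suc_le_eq)
      then show False using a b by auto
    qed
    then show "a \<in> {a \<in> {1..q}. \<forall>p\<in>insert p P. \<not> p dvd a}" using a by (auto simp: C_def)
  qed (auto simp: C_def)
  have sub: "(*) p ` C r \<subseteq> C q"
    using p1 r Pr ndvd by (auto simp: C_def Suc_le_eq prime_dvd_mult_iff)
  have fin: "finite (C q)" for q by (simp add: C_def)
  have "card (C q - (*) p ` C r) = card (C q) - card ((*) p ` C r)"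
    using sub fin by (intro card_Diff_subset) auto
  moreover have "card ((*) p ` C r) \<le> card (C q)" using sub fin by (intro card_mono) auto
  moreover have "card ((*) p ` C r) = card (C r)"
    using p1 by (intro card_image) (auto simp: inj_on_def)
  ultimately have "real (card (C q - (*) p ` C r)) = real (card (C q)) - real (card (C r))"
    by simp
  also have "\<dots> = real q * (\<Prod>p\<in>P. 1 - 1 / real p) - real r * (\<Prod>p\<in>P. 1 - 1 / real p)"
    using insert.IH[of q] insert.IH[of r] insert.prems r1 Pr unfolding C_def by simp
  also have "\<dots> = real q * (\<Prod>p\<in>insert p P. 1 - 1 / real p)"
    using insert.hyps r p1 by (simp add: field_simps)
  finally show ?case unfolding eq .
qed

section \<open>Integers divisible by nearly all small primes\<close>

text \<open>
  The primes in \<open>[2 ^ i, 2 ^ (i + 1))\<close>: any two of them differ by a factor less than \<open>2\<close>, and the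
  ranges partition the primes.
\<close>

definition dyadic_primes :: "nat \<Rightarrow> nat set" where
  "dyadic_primes i = {p. prime p \<and> 2 ^ i \<le> p \<and> p < 2 ^ Suc i}"

text \<open>
  The primes of the \<open>i\<close>-th dyadic range that do not divide \<open>q\<close>.
\<close>

definition missing :: "nat \<Rightarrow> nat \<Rightarrow> nat set" where
  "missing i q = {p \<in> dyadic_primes i. \<not> p dvd q}"

text \<open>
  The integers that miss at most \<open>M\<close> primes in each of the first \<open>I\<close> dyadic ranges. Zero, being
  divisible by everything, belongs to this set.
\<close>

definition rich :: "nat \<Rightarrow> nat \<Rightarrow> nat set" where
  "rich M I = {q. \<forall>i<I. card (missing i q) \<le> M}"

lemma finite_dyadic_primes [simp]: "finite (dyadic_primes i)"
  unfolding dyadic_primes_def by (rule finite_subset[of _ "{..<2 ^ Suc i}"]) auto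

lemma finite_missing [simp]: "finite (missing i q)"
  unfolding missing_def by simp

lemma disjoint_dyadic_primes: "i \<noteq> j \<Longrightarrow> dyadic_primes i \<inter> dyadic_primes j = {}"
proof (induction i j rule: linorder_wlog)
  case (le i j)
  then have "(2::nat) ^ Suc i \<le> 2 ^ j" by (intro power_increasing) auto
  then show ?case by (auto simp: dyadic_primes_def)
qed (simp add: Int_commute)

lemma UN_dyadic_primes: "(\<Union>i<I. dyadic_primes i) = {p. prime p \<and> p < 2 ^ I}"
proof (induction I)
  case 0
  then show ?case by (auto simp: less_Suc_eq dest: prime_gt_0_nat)
next
  case (Suc I)
  have "(\<Union>i<Suc I. dyadic_primes i) = {p. prime p \<and> p < 2 ^ I} \<union> dyadic_primes I"
    using Suc by (simp add: lessThan_Suc Un_commute)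
  also have "\<dots> = {p. prime p \<and> p < 2 ^ Suc I}"
    by (auto simp: dyadic_primes_def)
  finally show ?case .
qed

text \<open>
  The reason for the tolerance \<open>M\<close> in \<^const>\<open>rich\<close>: a prime \<open>p\<close> dividing a rich integer \<open>p * m\<close>
  can be exchanged for \<open>M\<close> primes of its own range (\<open>p\<close> itself may be among them). If \<open>p * m\<close>
  misses exactly \<open>M\<close> primes of the range, each of these can be put in; if it misses fewer, losing \<open>p\<close>
  does no harm, and every prime of the range will do.
\<close>

lemma rich_swap:
  assumes q: "q \<in> rich M I" and i: "i < I" and p: "p \<in> dyadic_primes i"
    and m: "q = p * m" and M: "M \<le> card (dyadic_primes i)"
  shows "M \<le> card {p' \<in> dyadic_primes i. p' * m \<in> rich M I}"
proof -
  have pp: "prime p" using p by (simp add: dyadic_primes_def)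
  have other: "missing j (p' * m) \<subseteq> missing j q" if "j \<noteq> i" for j p'
  proof
    fix r assume r: "r \<in> missing j (p' * m)"
    then have "r \<noteq> p" using disjoint_dyadic_primes[OF that] p by (auto simp: missing_def)
    then have "\<not> r dvd p" using r pp primes_dvd_imp_eq[of r p]
      by (auto simp: missing_def dyadic_primes_def)
    then show "r \<in> missing j q"
      using r m by (auto simp: missing_def dyadic_primes_def prime_dvd_mult_iff)
  qed
  have same: "missing i (p' * m) \<subseteq> insert p (missing i q) - {p'}" for p'
  proof
    fix r assume r: "r \<in> missing i (p' * m)"
    have "r \<noteq> p'" using r by (auto simp: missing_def)
    moreover have "r \<in> missing i q" if "r \<noteq> p"
    proof -
      have "\<not> r dvd p" using that r pp primes_dvd_imp_eq[of r p]
        by (auto simp: missing_def dyadic_primes_def)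
      then show ?thesis
        using r m by (auto simp: missing_def dyadic_primes_def prime_dvd_mult_iff)
    qed
    ultimately show "r \<in> insert p (missing i q) - {p'}" by auto
  qed
  have richI: "p' * m \<in> rich M I" if "card (missing i (p' * m)) \<le> M" for p'
    unfolding rich_def
  proof (clarify)
    fix j assume "j < I"
    show "card (missing j (p' * m)) \<le> M"
    proof (cases "j = i")
      case False
      then have "card (missing j (p' * m)) \<le> card (missing j q)"
        by (intro card_mono other) auto
      then show ?thesis using q \<open>j < I\<close> unfolding rich_def by force
    qed (use that in simp)
  qed
  have qM: "card (missing i q) \<le> M" using q i by (simp add: rich_def)
  show ?thesis
  proof (cases "card (missing i q) = M")
    case True
    have "missing i q \<subseteq> {p' \<in> dyadic_primes i. p' * m \<in> rich M I}"
    proof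
      fix p' assume p': "p' \<in> missing i q"
      then have "card (missing i (p' * m)) \<le> card (insert p (missing i q) - {p'})"
        by (intro card_mono same) auto
      also have "\<dots> \<le> M" using p' True by (simp add: card_insert_if)
      finally show "p' \<in> {p' \<in> dyadic_primes i. p' * m \<in> rich M I}"
        using richI p' by (auto simp: missing_def)
    qed
    from card_mono[OF _ this] show ?thesis using True by simp
  next
    case False
    have "p' * m \<in> rich M I" for p'
    proof (rule richI)
      have "card (missing i (p' * m)) \<le> card (insert p (missing i q))"
        using same[of p'] by (intro card_mono) auto
      also have "\<dots> \<le> M" using False qM by (simp add: card_insert_if)
      finally show "card (missing i (p' * m)) \<le> M" .
    qed
    then show ?thesis using M by simp
  qed
qed

text \<open>
  The primes to which \<open>rich_swap\<close> applies: those in a range with at least \<open>M\<close> primes.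
\<close>

definition swap_primes :: "nat \<Rightarrow> nat \<Rightarrow> nat set" where
  "swap_primes M I = (\<Union>i\<in>{i. i < I \<and> M \<le> card (dyadic_primes i)}. dyadic_primes i)"

lemma finite_swap_primes [simp]: "finite (swap_primes M I)"
  by (simp add: swap_primes_def)

text \<open>
  The primes below \<open>2 ^ I\<close> that are not counted on the right number at most \<open>M\<close> in each range \<open>i\<close>, and
  each of them contributes at most \<open>2 ^ - i\<close>. The loss is therefore bounded independently of \<open>I\<close>.
\<close>

lemma swap_primes_sum:
  assumes "q \<in> rich M I"
  shows "(\<Sum>p | prime p \<and> p < 2 ^ I. 1 / real p) - 2 * M
           \<le> (\<Sum>p | p \<in> swap_primes M I \<and> p dvd q. 1 / real p)"
proof -
  \<comment> \<open>In a range with fewer than \<open>M\<close> primes all of them are given up.\<close>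
  define E where "E i = (if M \<le> card (dyadic_primes i) then missing i q else dyadic_primes i)" for i
  define G where "G = {p \<in> swap_primes M I. p dvd q}"
  have E: "finite (E i)" "E i \<subseteq> dyadic_primes i" for i
    by (auto simp: E_def missing_def)
  have Ec: "card (E i) \<le> M" if "i < I" for i
    using that assms by (auto simp: E_def rich_def)
  have "{p. prime p \<and> p < 2 ^ I} \<subseteq> G \<union> (\<Union>i<I. E i)"
    unfolding UN_dyadic_primes[symmetric] G_def swap_primes_def E_def missing_def by auto
  then have "(\<Sum>p | prime p \<and> p < 2 ^ I. 1 / real p) \<le> (\<Sum>p\<in>G \<union> (\<Union>i<I. E i). 1 / real p)"
    by (intro sum_mono2) (auto simp: G_def E)
  also have "\<dots> \<le> (\<Sum>p\<in>G. 1 / real p) + (\<Sum>p\<in>(\<Union>i<I. E i). 1 / real p)"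
    using sum.union_inter[of G "\<Union>i<I. E i" "\<lambda>p. 1 / real p"] 
      sum_nonneg[of "G \<inter> (\<Union>i<I. E i)" "\<lambda>p. 1 / real p"] by (simp add: E G_def)
  also have "(\<Sum>p\<in>(\<Union>i<I. E i). 1 / real p) = (\<Sum>i<I. \<Sum>p\<in>E i. 1 / real p)"
    using E disjoint_dyadic_primes by (intro sum.UNION_disjoint) blast+
  also have "\<dots> \<le> (\<Sum>i<I. real M * (1/2) ^ i)"
  proof (rule sum_mono)
    fix i assume "i \<in> {..<I}"
    have "(\<Sum>p\<in>E i. 1 / real p) \<le> of_nat (card (E i)) * ((1/2) ^ i)"
    proof (rule sum_bounded_above)
      fix p assume "p \<in> E i"
      then have "(2::nat) ^ i \<le> p" using E by (auto simp: dyadic_primes_def)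
      then have "(2::real) ^ i \<le> real p" by (metis of_nat_le_iff of_nat_numeral of_nat_power)
      then have "1 / real p \<le> 1 / 2 ^ i" by (intro frac_le) auto
      then show "1 / real p \<le> (1/2) ^ i" by (simp add: power_divide)
    qed
    also have "\<dots> \<le> real M * (1/2) ^ i" using Ec \<open>i \<in> {..<I}\<close> by (intro mult_right_mono) auto
    finally show "(\<Sum>p\<in>E i. 1 / real p) \<le> real M * (1/2) ^ i" .
  qed
  also have "\<dots> = real M * (\<Sum>i<I. (1/2) ^ i)" by (simp add: sum_distrib_left)
  also have "(\<Sum>i<I. (1/2::real) ^ i) \<le> 2" by (simp add: sum_gp_strict)
  finally show ?thesis by (simp add: G_def mult_left_mono)
qed

section \<open>Few distinct fractions with rich denominators\<close>

text \<open>
  The fractions in the unit interval that can be written, not necessarily in lowest terms, with a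
  denominator in \<open>S\<close>. The denominator \<open>0\<close>, if present, contributes the value \<open>0 / 0 = 0\<close>.
\<close>

definition fractions :: "nat set \<Rightarrow> real set" where
  "fractions S = {real a / real q |a q. q \<in> S \<and> a \<le> q}"

lemma fractions_eq: "fractions S = (\<lambda>(q, a). real a / real q) ` (SIGMA q:S. {..q})"
  unfolding fractions_def by force

lemma finite_fractions [simp]: "finite S \<Longrightarrow> finite (fractions S)"
  unfolding fractions_eq by simp

lemma coprime_numerators_le:
  assumes q: "q \<in> rich M I" "q \<ge> 1"
    and \<theta>: "exp (2 * real M - (\<Sum>p | prime p \<and> p < 2 ^ I. 1 / real p)) \<le> \<theta>"
  shows "real (card {a \<in> {1..q}. \<forall>p\<in>swap_primes M I. p dvd q \<longrightarrow> \<not> p dvd a}) \<le> \<theta> * real q"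
proof -
  define P where "P = {p \<in> swap_primes M I. p dvd q}"
  have P: "finite P" "\<forall>p\<in>P. prime p \<and> p dvd q"
    by (auto simp: P_def swap_primes_def dyadic_primes_def)
  have "{a \<in> {1..q}. \<forall>p\<in>swap_primes M I. p dvd q \<longrightarrow> \<not> p dvd a} = {a \<in> {1..q}. \<forall>p\<in>P. \<not> p dvd a}"
    by (auto simp: P_def)
  then have eq: "real (card {a \<in> {1..q}. \<forall>p\<in>swap_primes M I. p dvd q \<longrightarrow> \<not> p dvd a})
               = real q * (\<Prod>p\<in>P. 1 - 1 / real p)"
    using card_coprime_to_primes[OF P q(2)] by simp
  have "(\<Prod>p\<in>P. 1 - 1 / real p) \<le> (\<Prod>p\<in>P. exp (- 1 / real p))"
  proof (rule prod_mono)
    fix p assume "p \<in> P"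
    then have "p \<ge> 1" using P(2) prime_ge_1_nat by blast
    then show "0 \<le> 1 - 1 / real p \<and> 1 - 1 / real p \<le> exp (- 1 / real p)"
      using exp_ge_add_one_self[of "- 1 / real p"] by simp
  qed
  also have "\<dots> = exp (- (\<Sum>p\<in>P. 1 / real p))"
    using P(1) by (simp add: exp_sum sum_negf[symmetric])
  also have "\<dots> \<le> exp (2 * real M - (\<Sum>p | prime p \<and> p < 2 ^ I. 1 / real p))"
    using swap_primes_sum[OF q(1)] by (simp add: P_def)
  also note \<theta>
  finally have "(\<Prod>p\<in>P. 1 - 1 / real p) * real q \<le> \<theta> * real q" by (intro mult_right_mono) auto
  then show ?thesis unfolding eq by (simp add: mult.commute)
qed

text \<open>
  For large \<open>M\<close> and small \<open>\<theta>\<close>, the representations \<open>a / q\<close> with \<open>q\<close> rich in \<open>{2 * Y..<4 * Y}\<close> are far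
  more numerous than the fractions. Either no swap prime divides both \<open>a\<close> and \<open>q\<close>, which is rare by
  \<open>coprime_numerators_le\<close>; or some swap prime \<open>p\<close> does, and then exchanging the factor \<open>p\<close> in both \<open>a\<close>
  and \<open>q\<close> for other primes of its range gives \<open>M\<close> representations of the same fraction. Primes
  of one range differ by a factor less than \<open>2\<close>, so these have denominators in \<open>{Y..<8 * Y}\<close>, and
  double counting bounds the number of such fractions.
\<close>

lemma card_fractions_rich:
  assumes Y: "Y \<ge> 1"
    and \<theta>: "exp (2 * real M - (\<Sum>p | prime p \<and> p < 2 ^ I. 1 / real p)) \<le> \<theta>" "\<theta> < 1"
  shows "real M * real (card (fractions (rich M I \<inter> {2 * Y..<4 * Y})))
           \<le> real M * \<theta> * real (4 * Y) * real (card (rich M I \<inter> {2 * Y..<4 * Y}))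
              + real (8 * Y) * real (card (rich M I \<inter> {Y..<8 * Y}))"
proof -
  define S where "S = rich M I \<inter> {2 * Y..<4 * Y}"
  define S' where "S' = rich M I \<inter> {Y..<8 * Y}"
  define N where "N q = {a \<in> {1..q}. \<forall>p\<in>swap_primes M I. p dvd q \<longrightarrow> \<not> p dvd a}" for q
  define Bad where "Bad = (\<lambda>(q, a). real a / real q) ` (SIGMA q:S. N q)"
  define Good where "Good = fractions S - Bad"
  define R where "R x = {(q, a). q \<in> S' \<and> a \<le> q \<and> real a / real q = x}" for x
  have fin: "finite S" "finite S'" "\<And>q. finite (N q)" by (auto simp: S_def S'_def N_def)
  have \<theta>0: "\<theta> > 0" using \<theta>(1) by (rule less_le_trans[OF exp_gt_zero])
  have N: "real (card (N q)) \<le> \<theta> * real q" if "q \<in> S" for q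
    unfolding N_def using that Y by (intro coprime_numerators_le \<theta>) (auto simp: S_def)
  have bad: "real (card Bad) \<le> \<theta> * real (4 * Y) * real (card S)"
  proof -
    have "card Bad \<le> card (SIGMA q:S. N q)" unfolding Bad_def using fin by (intro card_image_le) auto
    also have "\<dots> = (\<Sum>q\<in>S. card (N q))" using fin by (intro card_SigmaI) auto
    finally have "real (card Bad) \<le> (\<Sum>q\<in>S. real (card (N q)))" by (simp flip: of_nat_sum)
    also have "\<dots> \<le> real (card S) * (\<theta> * real (4 * Y))"
    proof (rule sum_bounded_above)
      fix q assume q: "q \<in> S"
      have "\<theta> * real q \<le> \<theta> * real (4 * Y)"
        using q \<theta>0 by (intro mult_left_mono) (auto simp: S_def)
      with N[OF q] show "real (card (N q)) \<le> \<theta> * real (4 * Y)" by linarith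
    qed
    finally show ?thesis by (simp add: mult_ac)
  qed
  have finR: "finite (R x)" for x
    by (rule finite_subset[of _ "SIGMA q:S'. {..q}"]) (auto simp: R_def fin)
  have R: "M \<le> card (R x)" if x: "x \<in> Good" for x
  proof -
    obtain q a where q: "q \<in> S" "a \<le> q" "x = real a / real q"
      using x by (auto simp: Good_def fractions_def)
    have q1: "q \<ge> 1" using q Y by (auto simp: S_def)
    have "a \<notin> N q" using q x by (auto simp: Good_def Bad_def)
    \<comment> \<open>This is needed for \<open>a = 0\<close>, where it yields some swap prime dividing \<open>q\<close>.\<close>
    moreover have "N q \<noteq> {1..q}"
    proof
      assume "N q = {1..q}"
      then have "real q \<le> \<theta> * real q" using N[OF q(1)] by simp
      with q1 \<theta>(2) show False by simp
    qed
    ultimately obtain p where p: "p \<in> swap_primes M I" "p dvd q" "p dvd a"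
      using q(2) by (cases "a = 0") (auto simp: N_def)
    then obtain i where i: "i < I" "M \<le> card (dyadic_primes i)" "p \<in> dyadic_primes i"
      by (auto simp: swap_primes_def)
    obtain m b where mb: "q = p * m" "a = p * b" using p by (auto elim!: dvdE)
    have m0: "m > 0" and p0: "p > 0" using mb q1 by (auto intro: Nat.gr0I)
    define T where "T = {p' \<in> dyadic_primes i. p' * m \<in> rich M I}"
    have "(\<lambda>p'. (p' * m, p' * b)) ` T \<subseteq> R x"
    proof clarify
      fix p' assume p': "p' \<in> T"
      have c: "p' < 2 * p" "p < 2 * p'" using p' i(3) by (auto simp: T_def dyadic_primes_def)
      have "p' * m < 2 * (p * m)" "p * m < 2 * (p' * m)"
        using mult_strict_right_mono[OF c(1) m0] mult_strict_right_mono[OF c(2) m0] by (simp_all only: mult.assoc)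
      moreover have "2 * Y \<le> p * m" "p * m < 4 * Y" using q(1) mb(1) by (auto simp: S_def)
      ultimately have "Y \<le> p' * m" "p' * m < 8 * Y" by linarith+
      moreover have "b \<le> m" using q(2) mb p0 by simp
      moreover have "p' > 0" using c by simp
      ultimately show "(p' * m, p' * b) \<in> R x"
        using p' p0 by (simp add: R_def S'_def T_def q(3) mb)
    qed
    then have "card ((\<lambda>p'. (p' * m, p' * b)) ` T) \<le> card (R x)" by (intro card_mono finR)
    moreover have "card ((\<lambda>p'. (p' * m, p' * b)) ` T) = card T"
      using m0 by (intro card_image) (auto simp: inj_on_def)
    moreover have "M \<le> card T"
      unfolding T_def using q(1) i mb(1) by (intro rich_swap) (auto simp: S_def)
    ultimately show ?thesis by simp
  qed
  have finG: "finite Good" using fin by (simp add: Good_def)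
  have "card Good * M \<le> (\<Sum>x\<in>Good. card (R x))"
    using sum_bounded_below[of Good M "\<lambda>x. card (R x)"] R by simp
  also have "\<dots> = card (\<Union>x\<in>Good. R x)"
    using finG finR by (intro card_UN_disjoint[symmetric]) (auto simp: R_def)
  also have "\<dots> \<le> card (SIGMA q:S'. {..q})"
    using fin by (intro card_mono) (auto simp: R_def)
  also have "\<dots> = (\<Sum>q\<in>S'. Suc q)" using fin by (subst card_SigmaI) auto
  also have "\<dots> \<le> card S' * (8 * Y)"
    using sum_bounded_above[of S' Suc "8 * Y"] by (auto simp: S'_def)
  finally have "real (card Good * M) \<le> real (card S' * (8 * Y))" by (rule of_nat_mono)
  then have good: "real M * real (card Good) \<le> real (8 * Y) * real (card S')"
    by (simp add: mult_ac)
  have "card (fractions S) \<le> card (Bad \<union> Good)"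
    using fin finG by (intro card_mono) (auto simp: Good_def Bad_def)
  also have "\<dots> \<le> card Bad + card Good" by (rule card_Un_le)
  finally have "real (card (fractions S)) \<le> real (card Bad) + real (card Good)" by linarith
  also have "\<dots> \<le> \<theta> * real (4 * Y) * real (card S) + real (card Good)" using bad by simp
  finally have "real M * real (card (fractions S))
      \<le> real M * (\<theta> * real (4 * Y) * real (card S) + real (card Good))"
    by (rule mult_left_mono) simp
  with good show ?thesis unfolding S_def[symmetric] S'_def[symmetric]
    by (simp add: algebra_simps)
qed

lemma card_periodic:
  fixes S :: "nat set"
  assumes per: "\<And>q. q + Q \<in> S \<longleftrightarrow> q \<in> S"
  shows "card (S \<inter> {a * Q..<(a + n) * Q}) = n * card (S \<inter> {..<Q})"
proof (induction n)
  case (Suc n)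
  have per': "q + k * Q \<in> S \<longleftrightarrow> q \<in> S" for q k
  proof (induction k)
    case (Suc k)
    then show ?case using per[of "q + k * Q"] by (simp add: algebra_simps)
  qed simp
  define L where "L = (a + n) * Q"
  have eq: "S \<inter> {L..<L + Q} = (\<lambda>q. q + L) ` (S \<inter> {..<Q})"
  proof (intro equalityI subsetI)
    fix q assume q: "q \<in> S \<inter> {L..<L + Q}"
    then have "q - L \<in> S \<inter> {..<Q}" using per'[of "q - L" "a + n"] by (auto simp: L_def)
    then show "q \<in> (\<lambda>q. q + L) ` (S \<inter> {..<Q})" using q by (intro image_eqI[of _ _ "q - L"]) auto
  qed (use per' in \<open>auto simp: L_def\<close>)
  have "S \<inter> {a * Q..<(a + Suc n) * Q} = (S \<inter> {a * Q..<L}) \<union> (S \<inter> {L..<L + Q})"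
    by (auto simp: L_def algebra_simps)
  moreover have "(S \<inter> {a * Q..<L}) \<inter> (S \<inter> {L..<L + Q}) = {}" by auto
  ultimately have "card (S \<inter> {a * Q..<(a + Suc n) * Q}) = card (S \<inter> {a * Q..<L}) + card (S \<inter> {L..<L + Q})"
    by (simp add: card_Un_disjoint)
  also have "card (S \<inter> {L..<L + Q}) = card (S \<inter> {..<Q})"
    unfolding eq by (intro card_image) auto
  finally show ?case using Suc by (simp add: L_def)
qed simp

text \<open>
  The set constructed is periodic with period \<open>Q\<close>, hence the exact count of its members at every
  scale. The last conclusion says that only a proportion of order \<open>\<eta>\<close> of the pairs \<open>(a, q)\<close> survives as distinct
  fractions.
\<close>

lemma exists_set_with_few_fractions:
  fixes \<eta> :: real
  assumes "\<eta> > 0"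
  obtains S :: "nat set" and Q :: nat where "Q \<ge> 1" "card (S \<inter> {..<Q}) \<ge> 1"
    "\<And>Z. Z \<ge> 1 \<Longrightarrow> card (S \<inter> {2 * Z * Q..<4 * Z * Q}) = 2 * Z * card (S \<inter> {..<Q})"
    "\<And>Z. Z \<ge> 1 \<Longrightarrow> real (card (fractions (S \<inter> {2 * Z * Q..<4 * Z * Q})))
        \<le> \<eta> * real (2 * Z * Q) * real (card (S \<inter> {2 * Z * Q..<4 * Z * Q}))"
proof -
  \<comment> \<open>For these \<open>M\<close> and \<open>\<theta>\<close>, each of the two terms in \<open>card_fractions_rich\<close> gives at most half of the bound.\<close>
  obtain M :: nat where M: "M > 28 / \<eta>" using reals_Archimedean2 by blast
  have M0: "M > 0" using M assms by (auto intro!: Nat.gr0I)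
  \<comment> \<open>The tolerance \<open>M\<close> is fixed first; then \<open>I\<close> is taken so large that the prime sum is at least \<open>2 * M - ln \<theta>\<close>.\<close>
  define \<theta> where "\<theta> = min (1/2) (\<eta> / 4)"
  have \<theta>: "\<theta> > 0" "\<theta> < 1" using assms by (auto simp: \<theta>_def)
  define B where "B = 2 * real M - ln \<theta>"
  have ev: "eventually (\<lambda>I. ln (ln (real I + 1)) \<ge> 2 * B) at_top"
    by real_asymp
  obtain N where N: "N \<ge> 1" "ln (ln (real N + 1)) \<ge> 2 * B"
    using eventually_happens[OF eventually_conj[OF eventually_ge_at_top[of 1] ev]] by auto
  define I where "I = N"
  define S where "S = rich M I"
  define Q where "Q = \<Prod>{p::nat. prime p \<and> p < 2 ^ I}"
  define s where "s = card (S \<inter> {..<Q})"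
  have finP: "finite {p::nat. prime p \<and> p < 2 ^ I}"
    by (rule finite_subset[of _ "{..<2 ^ I}"]) auto
  have Q: "Q \<ge> 1" unfolding Q_def
    by (rule prod_ge_1) (metis mem_Collect_eq prime_ge_1_nat)
  have "N < 2 ^ I" unfolding I_def by (rule less_exp)
  then have "(\<Sum>p | prime p \<and> p \<le> N. 1 / real p) \<le> (\<Sum>p | prime p \<and> p < 2 ^ I. 1 / real p)"
    using finP by (intro sum_mono2) auto
  then have "exp (2 * real M - (\<Sum>p | prime p \<and> p < 2 ^ I. 1 / real p)) \<le> exp (ln \<theta>)"
    using ln_le_sum_prime_reciprocals[OF N(1)] N(2) by (subst exp_le_cancel_iff) (simp add: B_def)
  then have \<theta>': "exp (2 * real M - (\<Sum>p | prime p \<and> p < 2 ^ I. 1 / real p)) \<le> \<theta>"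
    using \<theta> by simp
  have per: "q + Q \<in> S \<longleftrightarrow> q \<in> S" for q
  proof -
    have "missing i (q + Q) = missing i q" if "i < I" for i
    proof -
      have "p dvd Q" if "p \<in> dyadic_primes i" for p
      proof -
        have "p \<in> {p. prime p \<and> p < 2 ^ I}"
          using UN_dyadic_primes[of I] that \<open>i < I\<close> by blast
        then show ?thesis unfolding Q_def using finP by (intro dvd_prodI[where f = id, simplified]) auto
      qed
      then show ?thesis by (auto simp: missing_def dvd_add_left_iff)
    qed
    then show ?thesis by (auto simp: S_def rich_def)
  qed
  have "0 \<in> S \<inter> {..<Q}" using Q by (auto simp: S_def rich_def missing_def)
  then have s: "s \<ge> 1" unfolding s_def by (metis One_nat_def Suc_leI card_gt_0_iff empty_iff finite_Int finite_lessThan)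
  have c1: "card (S \<inter> {2 * Z * Q..<4 * Z * Q}) = 2 * Z * s" for Z
    using card_periodic[OF per, of "2 * Z" "2 * Z"] by (simp add: s_def)
  have c2: "card (S \<inter> {Z * Q..<8 * Z * Q}) = 7 * Z * s" for Z
    using card_periodic[OF per, of "Z" "7 * Z"] by (simp add: s_def)
  show ?thesis
  proof (rule that[OF Q s[unfolded s_def] c1[unfolded s_def]])
    fix Z :: nat assume Z: "Z \<ge> 1"
    have ZQ: "1 \<le> Z * Q" using Z Q by simp
    define F where "F = real (card (fractions (S \<inter> {2 * Z * Q..<4 * Z * Q})))"
    have "real M * F \<le> real M * \<theta> * real (4 * (Z * Q)) * real (2 * Z * s)
        + real (8 * (Z * Q)) * real (7 * Z * s)"
      using card_fractions_rich[OF ZQ \<theta>' \<theta>(2)] c1[of Z] c2[of Z]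
      unfolding F_def S_def[symmetric] mult.assoc[of _ Z Q] by simp
    also have "\<dots> = (2 * (real M * \<theta>) + 14) * (real (2 * Z * Q) * real (2 * Z * s))"
      by (simp add: algebra_simps)
    also have "\<dots> \<le> (real M * \<eta>) * (real (2 * Z * Q) * real (2 * Z * s))"
    proof (rule mult_right_mono)
      have "real M * \<theta> \<le> real M * (\<eta> / 4)" by (intro mult_left_mono) (auto simp: \<theta>_def)
      moreover have "28 < real M * \<eta>" using M assms by (simp add: field_simps)
      ultimately show "2 * (real M * \<theta>) + 14 \<le> real M * \<eta>" by simp
    qed simp
    finally have "real M * F \<le> real M * (\<eta> * real (2 * Z * Q) * real (2 * Z * s))"
      by (simp add: mult_ac)
    then have "F \<le> \<eta> * real (2 * Z * Q) * real (2 * Z * s)"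
      using M0 by (subst (asm) mult_le_cancel_left_pos) auto
    then show "real (card (fractions (S \<inter> {2 * Z * Q..<4 * Z * Q})))
        \<le> \<eta> * real (2 * Z * Q) * real (card (S \<inter> {2 * Z * Q..<4 * Z * Q}))"
      unfolding F_def c1 .
  qed
qed

section \<open>Covering by neighbourhoods of fractions\<close>

text \<open>
  The \<open>\<delta>\<close>-neighbourhood of \<open>F\<close>, formed from closed intervals.
\<close>

definition nbhd :: "real set \<Rightarrow> real \<Rightarrow> real set" where
  "nbhd F \<delta> = (\<Union>x\<in>F. {x - \<delta>..x + \<delta>})"

lemma nbhd_lmeasurable: "finite F \<Longrightarrow> nbhd F \<delta> \<in> lmeasurable"
  unfolding nbhd_def by (intro fmeasurable.finite_UN) auto

lemma measure_nbhd_le: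
  assumes "finite F" "\<delta> \<ge> 0"
  shows "measure lebesgue (nbhd F \<delta>) \<le> real (card F) * (2 * \<delta>)"
proof -
  have "measure lebesgue (nbhd F \<delta>) \<le> (\<Sum>x\<in>F. measure lebesgue {x - \<delta>..x + \<delta>})"
    unfolding nbhd_def using assms by (intro measure_UNION_le) auto
  also have "\<dots> = real (card F) * (2 * \<delta>)" using assms by simp
  finally show ?thesis .
qed

lemma near_fraction:
  assumes \<alpha>: "\<alpha> \<in> {0..1}" and q: "q \<in> T" and X: "0 < X" "X \<le> real q"
    and near: "nearest_int_dist (real q * \<alpha>) < c"
  shows "\<alpha> \<in> nbhd (fractions T) (c / X)"
proof -
  have q0: "real q > 0" using X by linarith
  define r where "r = round (real q * \<alpha>)"
  have "round (0::real) \<le> r" unfolding r_def using \<alpha> q0 by (intro round_mono) simp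
  then have r0: "0 \<le> r" by simp
  have "r \<le> round (real q)" unfolding r_def using \<alpha> q0 by (intro round_mono) (simp add: mult_left_le)
  then have r1: "r \<le> int q" by simp
  have d: "\<bar>real q * \<alpha> - of_int r\<bar> < c"
    using near by (simp add: nearest_int_dist_eq_round r_def)
  have "\<alpha> - real (nat r) / real q = (real q * \<alpha> - of_int r) / real q"
    using q0 r0 by (simp add: field_simps)
  then have "\<bar>\<alpha> - real (nat r) / real q\<bar> = \<bar>real q * \<alpha> - of_int r\<bar> / real q"
    using q0 by simp
  also have "\<dots> \<le> c / real q" using d q0 by (intro divide_right_mono) auto
  also have "\<dots> \<le> c / X" using d X by (intro divide_left_mono) auto
  finally have "\<alpha> \<in> {real (nat r) / real q - c / X..real (nat r) / real q + c / X}" by auto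
  moreover have "real (nat r) / real q \<in> fractions T"
    unfolding fractions_def using q r0 r1 by (intro CollectI exI[of _ "nat r"] exI[of _ q]) auto
  ultimately show ?thesis unfolding nbhd_def by blast
qed

lemma nearest_int_dist_nonneg: "nearest_int_dist x \<ge> 0"
  by (simp add: nearest_int_dist_eq_round)

section \<open>Locating an integer between consecutive terms\<close>

text \<open>
  For strictly increasing \<open>X\<close> with \<open>X 0 \<le> q\<close>: the index \<open>j\<close> with \<open>X j \<le> q < X (Suc j)\<close>.
\<close>

definition step_index :: "(nat \<Rightarrow> nat) \<Rightarrow> nat \<Rightarrow> nat" where
  "step_index X q = (LEAST j. q < X (Suc j))"

lemma step_index_eq:
  assumes "strict_mono X" "X j \<le> q" "q < X (Suc j)"
  shows "step_index X q = j"
  unfolding step_index_def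
proof (rule Least_equality)
  fix i assume "q < X (Suc i)"
  then have "X j < X (Suc i)" using assms by linarith
  then show "j \<le> i" using assms(1) by (simp add: strict_mono_less)
qed (rule assms)

lemma step_index_bounds:
  assumes "strict_mono X" "X 0 \<le> q"
  shows "X (step_index X q) \<le> q" "q < X (Suc (step_index X q))"
proof -
  have "\<exists>j. q < X (Suc j)"
    using strict_mono_imp_increasing[OF assms(1), of "Suc q"] by (intro exI[of _ q]) linarith
  then show less: "q < X (Suc (step_index X q))"
    unfolding step_index_def by (rule LeastI_ex)
  show "X (step_index X q) \<le> q"
  proof (cases "step_index X q")
    case (Suc j)
    then have "\<not> q < X (Suc j)" unfolding step_index_def by (intro not_less_Least) simp
    then show ?thesis using Suc by simp
  qed (use assms in simp)
qed

lemma step_index_less_iff: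
  assumes "strict_mono X" "X 0 \<le> q"
  shows "step_index X q < j \<longleftrightarrow> q < X j"
proof
  assume "step_index X q < j"
  then have "X (Suc (step_index X q)) \<le> X j" using assms(1) by (simp add: strict_mono_less_eq)
  then show "q < X j" using step_index_bounds[OF assms] by linarith
next
  assume "q < X j"
  then have "X (step_index X q) < X j" using step_index_bounds[OF assms] by linarith
  then show "step_index X q < j" using assms(1) by (simp add: strict_mono_less)
qed

section \<open>Blocks\<close>

text \<open>
  A piece \<open>g\<close> of the function to be built, on the integers of \<open>{N..<N'}\<close>. It lies below \<open>f\<close>, and it is
  non-increasing on its support, where its values lie between \<open>c'\<close> and \<open>c\<close>; successive blocks whose
  bounds \<open>c\<close> match up can therefore be concatenated without spoiling monotonicity. The set \<open>U\<close>, of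
  measure at most \<open>\<epsilon>\<close>, contains every \<open>\<alpha>\<close> in the unit interval for which the distance of \<open>q * \<alpha>\<close> to
  the nearest integer is below \<open>g q\<close> for some \<open>q\<close> of the block.
\<close>

definition block :: "(nat \<Rightarrow> real) \<Rightarrow> real \<Rightarrow> nat \<Rightarrow> real \<Rightarrow> nat \<Rightarrow> real \<Rightarrow> (nat \<Rightarrow> real) \<Rightarrow> real set \<Rightarrow> bool" where
  "block f \<epsilon> N c N' c' g U \<longleftrightarrow>
     N < N' \<and> 0 < c' \<and> c' \<le> c \<and>
     (\<forall>q\<in>{N..<N'}. g q = 0 \<or> c' \<le> g q \<and> g q \<le> c) \<and>
     (\<forall>q\<in>{N..<N'}. g q \<le> f q) \<and>
     antimono_on {q \<in> {N..<N'}. g q \<noteq> 0} g \<and>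
     U \<in> lmeasurable \<and> measure lebesgue U \<le> \<epsilon> \<and>
     (\<forall>q\<in>{N..<N'}. \<forall>\<alpha>\<in>{0..1}. nearest_int_dist (real q * \<alpha>) < g q \<longrightarrow> \<alpha> \<in> U)"

lemma block_append:
  assumes g: "block f \<epsilon> N c N1 c1 g U" and h: "block f \<epsilon>' N1 c1 N2 c2 h V"
  shows "block f (\<epsilon> + \<epsilon>') N c N2 c2 (\<lambda>q. if q < N1 then g q else h q) (U \<union> V)"
proof -
  have "measure lebesgue (U \<union> V) \<le> measure lebesgue U + measure lebesgue V"
    using g h by (intro measure_Un_le) (auto simp: block_def)
  then have m: "measure lebesgue (U \<union> V) \<le> \<epsilon> + \<epsilon>'" using g h by (auto simp: block_def)
  have ga: "antimono_on {q \<in> {N..<N1}. g q \<noteq> 0} g" and ha: "antimono_on {q \<in> {N1..<N2}. h q \<noteq> 0} h"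
    using g h by (simp_all add: block_def)
  have gb: "c1 \<le> g q" if "q \<in> {N..<N1}" "g q \<noteq> 0" for q
    using g that unfolding block_def by blast
  have hb: "h q \<le> c1" if "q \<in> {N1..<N2}" "h q \<noteq> 0" for q
    using h that unfolding block_def by blast
  have anti: "antimono_on {q \<in> {N..<N2}. (if q < N1 then g q else h q) \<noteq> 0} (\<lambda>q. if q < N1 then g q else h q)"
  proof (rule monotone_onI)
    fix q r assume q: "q \<in> {q \<in> {N..<N2}. (if q < N1 then g q else h q) \<noteq> 0}"
      and r: "r \<in> {q \<in> {N..<N2}. (if q < N1 then g q else h q) \<noteq> 0}" and qr: "q \<le> r"
    consider "r < N1" | "q < N1" "N1 \<le> r" | "N1 \<le> q" by linarith
    then show "(if q < N1 then g q else h q) \<ge> (if r < N1 then g r else h r)"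
    proof cases
      case 1
      then have "g r \<le> g q" using q r qr by (intro monotone_onD[OF ga]) auto
      then show ?thesis using 1 qr by simp
    next
      case 2
      then have "c1 \<le> g q" "h r \<le> c1" using q r by (auto intro: gb hb)
      then show ?thesis using 2 by simp
    next
      case 3
      then have "h r \<le> h q" using q r qr by (intro monotone_onD[OF ha]) auto
      then show ?thesis using 3 qr by simp
    qed
  qed
  show ?thesis unfolding block_def
  proof (intro conjI anti m ballI impI)
    fix q assume q: "q \<in> {N..<N2}"
    show "(if q < N1 then g q else h q) = 0 \<or>
        c2 \<le> (if q < N1 then g q else h q) \<and> (if q < N1 then g q else h q) \<le> c"
    proof (cases "q < N1")
      case True
      then have "g q = 0 \<or> c1 \<le> g q \<and> g q \<le> c" "c2 \<le> c1" using q g h by (auto simp: block_def)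
      then show ?thesis using True by auto
    next
      case False
      then have "h q = 0 \<or> c2 \<le> h q \<and> h q \<le> c1" "c1 \<le> c" using q g h by (auto simp: block_def)
      then show ?thesis using False by auto
    qed
    fix \<alpha> :: real assume \<alpha>: "\<alpha> \<in> {0..1}"
      and near: "nearest_int_dist (real q * \<alpha>) < (if q < N1 then g q else h q)"
    show "\<alpha> \<in> U \<union> V"
    proof (cases "q < N1")
      case True
      then have "q \<in> {N..<N1}" "nearest_int_dist (real q * \<alpha>) < g q" using q near by auto
      then have "\<alpha> \<in> U" using g \<alpha> unfolding block_def by blast
      then show ?thesis ..
    next
      case False
      then have "q \<in> {N1..<N2}" "nearest_int_dist (real q * \<alpha>) < h q" using q near by auto
      then have "\<alpha> \<in> V" using h \<alpha> unfolding block_def by blast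
      then show ?thesis ..
    qed
  qed (use g h in \<open>auto simp: block_def split: if_splits\<close>)
qed

text \<open>
  Density costs nothing: a constant that is tiny compared with \<open>1 / N'\<close> is positive on the whole block
  and still approximates only a set of small measure.
\<close>

lemma exists_dense_block:
  assumes f_pos: "\<And>q. q \<ge> 1 \<Longrightarrow> f q > 0"
    and f_anti: "\<And>p q. 1 \<le> p \<Longrightarrow> p \<le> q \<Longrightarrow> f q \<le> f p"
    and N: "N \<ge> 1" and c: "c > 0" and \<epsilon>: "\<epsilon> > 0"
  shows "\<exists>N' c' g U. block f \<epsilon> N c N' c' g U \<and>
           (1 - \<epsilon>) * real (N' - 1) \<le> real (card {q \<in> {N..<N'}. g q \<noteq> 0})"
proof -
  obtain K :: nat where K: "real K > real N / \<epsilon>" using reals_Archimedean2 by blast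
  define N' where "N' = Suc (N + K)"
  define d where "d = min (min c (f N')) (\<epsilon> / (4 * real N'))"
  define U where "U = (\<Union>q\<in>{N..<N'}. nbhd (fractions {q}) (d / real q))"
  have d: "d > 0" "d \<le> c" "d \<le> f N'" "d \<le> \<epsilon> / (4 * real N')"
    using c \<epsilon> f_pos[of N'] by (auto simp: d_def N'_def)
  have "measure lebesgue U \<le> (\<Sum>q\<in>{N..<N'}. measure lebesgue (nbhd (fractions {q}) (d / real q)))"
    unfolding U_def by (intro measure_UNION_le) (auto intro!: fmeasurableD nbhd_lmeasurable)
  also have "\<dots> \<le> of_nat (card {N..<N'}) * (4 * d)"
  proof (rule sum_bounded_above)
    fix q assume q: "q \<in> {N..<N'}"
    have "card (fractions {q}) \<le> card (SIGMA q:{q}. {..q})"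
      unfolding fractions_eq by (intro card_image_le) auto
    then have "card (fractions {q}) \<le> Suc q" by simp
    then have cf: "real (card (fractions {q})) \<le> 2 * real q" using q N by simp
    have "measure lebesgue (nbhd (fractions {q}) (d / real q))
            \<le> real (card (fractions {q})) * (2 * (d / real q))"
      using d by (intro measure_nbhd_le) auto
    also have "\<dots> \<le> 2 * real q * (2 * (d / real q))"
      using d cf by (intro mult_right_mono) auto
    also have "\<dots> = 4 * d" using q N by simp
    finally show "measure lebesgue (nbhd (fractions {q}) (d / real q)) \<le> 4 * d" .
  qed
  also have "\<dots> \<le> real N' * (4 * d)" using d by (intro mult_right_mono) auto
  also have "\<dots> \<le> \<epsilon>" using d(4) by (simp add: N'_def field_simps)
  finally have mU: "measure lebesgue U \<le> \<epsilon>" .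
  have b: "block f \<epsilon> N c N' d (\<lambda>_. d) U"
    unfolding block_def
  proof (intro conjI ballI impI mU)
    show "U \<in> lmeasurable" unfolding U_def
      by (intro fmeasurable.finite_UN) (auto intro: nbhd_lmeasurable)
    show "d \<le> f q" if "q \<in> {N..<N'}" for q
      using that d(3) f_anti[of q N'] N by simp
    show "\<alpha> \<in> U" if "q \<in> {N..<N'}" "\<alpha> \<in> {0..1}" "nearest_int_dist (real q * \<alpha>) < d" for q \<alpha>
      unfolding U_def using that N near_fraction[of \<alpha> q "{q}" "real q" d] by auto
  qed (use d in \<open>auto simp: N'_def monotone_on_def\<close>)
  have "(1 - \<epsilon>) * real (N' - 1) = real N + real K - \<epsilon> * (real N + real K)"
    by (simp add: N'_def algebra_simps)
  also have "\<dots> \<le> real K"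
  proof -
    have "real N \<le> \<epsilon> * real K" using K \<epsilon> by (simp add: field_simps)
    moreover have "0 \<le> \<epsilon> * real N" using \<epsilon> by simp
    ultimately show ?thesis by (simp add: algebra_simps)
  qed
  also have "\<dots> \<le> real (card {N..<N'})" by (simp add: N'_def)
  also have "{N..<N'} = {q \<in> {N..<N'}. d \<noteq> 0}" using d by auto
  finally show ?thesis using b by blast
qed

section \<open>Blocks of large total mass\<close>

lemma unit_step_partial_sum:
  fixes a :: "nat \<Rightarrow> real"
  assumes a: "\<And>j. 0 \<le> a j" "\<And>j. a j \<le> 1" and div: "\<not> summable a"
  obtains n where "n > m" "1 \<le> (\<Sum>j=m..<n. a j)" "(\<Sum>j=m..<n. a j) \<le> 2"
proof -
  have "\<exists>n. 1 \<le> (\<Sum>j=m..<n. a j)"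
  proof (rule ccontr)
    assume neg: "\<not> ?thesis"
    have "(\<Sum>j<n. a (j + m)) \<le> 1" for n
    proof -
      have "(\<Sum>j=0..<n. a (j + m)) = (\<Sum>j=m..<n + m. a j)"
        using sum.shift_bounds_nat_ivl[of a 0 m n] by simp
      then show ?thesis using neg by (simp add: not_le less_imp_le atLeast0LessThan)
    qed
    then have "summable (\<lambda>j. a (j + m))" using a by (intro summableI_nonneg_bounded) auto
    then show False using div by simp
  qed
  then have "\<exists>n. 1 \<le> (\<Sum>j=m..<n. a j) \<and> (\<forall>k<n. \<not> 1 \<le> (\<Sum>j=m..<k. a j))"
    by (rule exists_least_iff[THEN iffD1])
  then obtain n where n: "1 \<le> (\<Sum>j=m..<n. a j)" "\<And>k. k < n \<Longrightarrow> \<not> 1 \<le> (\<Sum>j=m..<k. a j)"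
    by blast
  have nm: "n > m" using n(1) by (rule contrapos_pp) simp
  then obtain k where k: "n = Suc k" "k \<ge> m" by (cases n) auto
  have "(\<Sum>j=m..<n. a j) = (\<Sum>j=m..<k. a j) + a k" using k by simp
  also have "\<dots> \<le> 2" using n(2)[of k] k a(2)[of k] by simp
  finally show thesis using that nm n(1) by blast
qed

text \<open>
  Cauchy condensation along a sequence \<open>X\<close> that grows at most like the powers of \<open>2\<close>. Truncating the terms at
  \<open>1\<close> keeps divergence: were the truncated series convergent, the truncation would eventually be idle.
\<close>

lemma not_summable_min_condensed:
  fixes f t :: "nat \<Rightarrow> real"
  assumes f_pos: "\<And>q. q \<ge> 1 \<Longrightarrow> f q > 0"
    and f_anti: "\<And>p q. 1 \<le> p \<Longrightarrow> p \<le> q \<Longrightarrow> f q \<le> f p"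
    and f_div: "\<not> summable f"
    and t: "\<And>j. 2 ^ j \<le> t j"
    and X: "\<And>j. 1 \<le> X j" "\<And>j. X j \<le> 2 ^ (j + r)"
  shows "\<not> summable (\<lambda>j. min (t j * f (X j)) 1)"
proof
  assume sm: "summable (\<lambda>j. min (t j * f (X j)) 1)"
  define f' where "f' n = (if n = 0 then 0 else f n)" for n :: nat
  have "summable f' \<longleftrightarrow> summable f"
    by (intro summable_cong eventually_mono[OF eventually_gt_at_top[of 0]]) (simp add: f'_def)
  moreover have "summable f' \<longleftrightarrow> summable (\<lambda>n. 2 ^ n * f' (2 ^ n))"
    using f_pos f_anti by (intro condensation_test) (auto simp: f'_def less_imp_le Suc_le_eq)
  ultimately have ns: "\<not> summable (\<lambda>n. 2 ^ n * f (2 ^ n))" using f_div by (simp add: f'_def)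
  have lower: "2 ^ (j + r) * f (2 ^ (j + r)) \<le> 2 ^ r * (t j * f (X j))" for j
  proof -
    have "2 ^ j * f (2 ^ (j + r)) \<le> t j * f (X j)"
      using t[of j] f_anti[OF X] f_pos[of "2 ^ (j + r)"] order_trans[OF zero_le_power t[of j]]
      by (intro mult_mono) auto
    then have "2 ^ r * (2 ^ j * f (2 ^ (j + r))) \<le> 2 ^ r * (t j * f (X j))"
      by (intro mult_left_mono) auto
    then show ?thesis by (simp add: power_add mult_ac)
  qed
  have "(\<lambda>j. min (t j * f (X j)) 1) \<longlonglongrightarrow> 0" by (rule summable_LIMSEQ_zero[OF sm])
  then have ev: "eventually (\<lambda>j. min (t j * f (X j)) 1 < 1) sequentially"
    by (rule order_tendstoD) simp
  have "summable (\<lambda>j. 2 ^ (j + r) * f (2 ^ (j + r)))"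
  proof (rule summable_comparison_test_ev)
    show "summable (\<lambda>j. 2 ^ r * min (t j * f (X j)) 1)" using sm by (rule summable_mult)
    show "eventually (\<lambda>j. norm (2 ^ (j + r) * f (2 ^ (j + r))) \<le> 2 ^ r * min (t j * f (X j)) 1) sequentially"
      using ev
    proof eventually_elim
      case (elim j)
      then have "min (t j * f (X j)) 1 = t j * f (X j)" by linarith
      moreover have "f (2 ^ (j + r)) > 0" using f_pos by simp
      ultimately show ?case using lower[of j] by (simp add: abs_mult)
    qed
  qed
  then have "summable (\<lambda>n. 2 ^ n * f (2 ^ n))"
    using summable_iff_shift[of "\<lambda>n. 2 ^ n * f (2 ^ n)" r] by simp
  with ns show False ..
qed

text \<open>
  On the dyadic scale \<open>{X j..<X (Suc j)}\<close> the function is a constant \<open>d j\<close> on the periodic set \<open>S\<close> of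
  \<open>exists_set_with_few_fractions\<close>. The mass of the scale is \<open>a j = t j * d j\<close>, where \<open>t j\<close> counts
  the members of \<open>S\<close> in it, while the approximated set is covered by intervals of length
  \<open>2 * d j / X j\<close> about at most \<open>\<epsilon> / 4 * X j * t j\<close> fractions and so has measure at most
  \<open>\<epsilon> / 2 * a j\<close>. Scales are used until the total mass lies between \<open>1\<close> and \<open>2\<close>.
\<close>

lemma exists_heavy_block:
  assumes f_pos: "\<And>q. q \<ge> 1 \<Longrightarrow> f q > 0"
    and f_anti: "\<And>p q. 1 \<le> p \<Longrightarrow> p \<le> q \<Longrightarrow> f q \<le> f p"
    and f_lim: "f \<longlonglongrightarrow> 0"
    and f_div: "\<not> summable f"
    and N: "N \<ge> 1" and c: "c > 0" and \<epsilon>: "\<epsilon> > 0"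
  shows "\<exists>N' c' g U. block f \<epsilon> N c N' c' g U \<and> 1 \<le> (\<Sum>q=N..<N'. g q)"
proof -
  obtain S :: "nat set" and Q :: nat where Q: "Q \<ge> 1" and s1: "card (S \<inter> {..<Q}) \<ge> 1"
    and count: "\<And>Z. Z \<ge> 1 \<Longrightarrow> card (S \<inter> {2 * Z * Q..<4 * Z * Q}) = 2 * Z * card (S \<inter> {..<Q})"
    and few: "\<And>Z. Z \<ge> 1 \<Longrightarrow> real (card (fractions (S \<inter> {2 * Z * Q..<4 * Z * Q})))
        \<le> \<epsilon> / 4 * real (2 * Z * Q) * real (card (S \<inter> {2 * Z * Q..<4 * Z * Q}))"
    using exists_set_with_few_fractions[of "\<epsilon> / 4"] \<epsilon> by (metis zero_less_divide_iff zero_less_numeral)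
  define X where "X j = 2 * 2 ^ j * Q" for j
  define T where "T j = S \<inter> {X j..<X (Suc j)}" for j
  define t where "t j = real (card (T j))" for j
  \<comment> \<open>The cap \<open>1 / t j\<close> makes the masses at most \<open>1\<close>, so that the total does not overshoot \<open>2\<close>.\<close>
  define d where "d j = min (f (X (Suc j))) (1 / t j)" for j
  define a where "a j = t j * d j" for j
  have T_eq: "T j = S \<inter> {2 * 2 ^ j * Q..<4 * 2 ^ j * Q}" for j
    by (simp add: T_def X_def)
  have t_eq: "t j = 2 * 2 ^ j * real (card (S \<inter> {..<Q}))" for j
    using count[of "2 ^ j"] by (simp add: t_def T_eq)
  have t_ge: "2 ^ j \<le> t j" for j
  proof -
    have "2 ^ j * 1 \<le> 2 ^ j * (2 * real (card (S \<inter> {..<Q})))"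
      using s1 by (intro mult_left_mono) auto
    then show ?thesis by (simp add: t_eq)
  qed
  have t0: "t j > 0" for j using t_ge[of j] by (rule less_le_trans[rotated]) simp
  have t_mono: "t i \<le> t j" if "i \<le> j" for i j
    using that by (simp add: t_eq mult_right_mono power_increasing)
  have X: "strict_mono X" using Q by (simp add: strict_mono_Suc_iff X_def)
  have X1: "X j \<ge> 1" for j using Q by (simp add: X_def)
  have Xj: "X j \<ge> j" for j using strict_mono_imp_increasing[OF X] .
  have d0: "d j > 0" for j using f_pos[OF X1] t0 by (simp add: d_def)
  have d_anti: "d j \<le> d i" if "i \<le> j" for i j
  proof -
    have "f (X (Suc j)) \<le> f (X (Suc i))"
      using that X X1 by (intro f_anti) (auto simp: strict_mono_less_eq)
    moreover have "1 / t j \<le> 1 / t i" using t_mono[OF that] t0 by (intro divide_left_mono) auto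
    ultimately show ?thesis unfolding d_def by (rule min.mono)
  qed
  have a_eq: "a j = min (t j * f (X (Suc j))) 1" for j
    using t0[of j] by (simp add: a_def d_def min_mult_distrib_left)
  have a_ge: "0 \<le> a j" for j using t0[of j] d0[of j] by (simp add: a_def)
  have a_le: "a j \<le> 1" for j by (simp add: a_eq)
  have a_div: "\<not> summable a"
  proof -
    have "4 * Q < 2 ^ (4 * Q)" by (rule less_exp)
    then have "X (Suc j) \<le> 2 ^ (j + 4 * Q)" for j by (simp add: X_def power_add)
    then have "\<not> summable (\<lambda>j. min (t j * f (X (Suc j))) 1)"
      by (intro not_summable_min_condensed f_pos f_anti f_div t_ge X1)
    then show ?thesis by (simp add: a_eq[abs_def])
  qed
  have "eventually (\<lambda>n. f n < c) sequentially" using f_lim c by (rule order_tendstoD)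
  then obtain n0 where n0: "\<And>n. n \<ge> n0 \<Longrightarrow> f n < c" by (auto simp: eventually_at_top_linorder)
  define j0 where "j0 = max N n0"
  obtain n where n: "n > j0" "1 \<le> (\<Sum>j=j0..<n. a j)" "(\<Sum>j=j0..<n. a j) \<le> 2"
    using unit_step_partial_sum[of a j0] a_ge a_le a_div by blast
  define J where "J = step_index X"
  define g where "g q = (if q \<in> S \<and> X j0 \<le> q then d (J q) else 0)" for q
  define N' where "N' = X n"
  define U where "U = (\<Union>j\<in>{j0..<n}. nbhd (fractions (T j)) (d j / real (X j)))"
  have NX: "N \<le> X j0" using Xj[of j0] by (simp add: j0_def)
  have NN': "N < N'" using NX n(1) X by (simp add: N'_def strict_mono_less le_less_trans)
  have X0: "X 0 \<le> q" if "X j0 \<le> q" for q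
    using that strict_mono_less_eq[OF X, of 0 j0] by simp
  have J: "J q \<in> {j0..<n}" "q \<in> T (J q)" if "q \<in> S" "X j0 \<le> q" "q < N'" for q
  proof -
    have "j0 \<le> J q" using step_index_less_iff[OF X X0[OF that(2)], of j0] that by (simp add: J_def)
    moreover have "J q < n"
      using step_index_less_iff[OF X X0[OF that(2)], of n] that by (simp add: J_def N'_def)
    ultimately show "J q \<in> {j0..<n}" by simp
    show "q \<in> T (J q)" using step_index_bounds[OF X X0[OF that(2)]] that by (simp add: T_def J_def)
  qed
  have gT: "g q = d j" "q \<in> {N..<N'}" if "q \<in> T j" "j \<in> {j0..<n}" for q j
  proof -
    have q: "q \<in> S" "X j \<le> q" "q < X (Suc j)" using that by (auto simp: T_def)
    have "X j0 \<le> X j" "X (Suc j) \<le> X n" using that X by (auto simp: strict_mono_less_eq)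
    then show "g q = d j" "q \<in> {N..<N'}"
      using q step_index_eq[OF X q(2,3)] NX by (auto simp: g_def J_def N'_def)
  qed
  have finT: "finite (T j)" for j by (simp add: T_def)
  have disjT: "T i \<inter> T j = {}" if "i \<noteq> j" for i j
  proof -
    have "i = j" if "q \<in> T i" "q \<in> T j" for q
      using that step_index_eq[OF X, of i q] step_index_eq[OF X, of j q] by (simp add: T_def)
    then show ?thesis using that by blast
  qed
  have "measure lebesgue U \<le> (\<Sum>j\<in>{j0..<n}. measure lebesgue (nbhd (fractions (T j)) (d j / real (X j))))"
    unfolding U_def by (intro measure_UNION_le) (auto intro!: fmeasurableD nbhd_lmeasurable finite_fractions finT)
  also have "\<dots> \<le> (\<Sum>j\<in>{j0..<n}. \<epsilon> / 2 * a j)"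
  proof (rule sum_mono)
    fix j
    have Xp: "real (X j) > 0" using X1[of j] by simp
    have "measure lebesgue (nbhd (fractions (T j)) (d j / real (X j)))
            \<le> real (card (fractions (T j))) * (2 * (d j / real (X j)))"
      using d0[of j] finT by (intro measure_nbhd_le) auto
    also have "\<dots> \<le> (\<epsilon> / 4 * real (X j) * t j) * (2 * (d j / real (X j)))"
      using few[of "2 ^ j"] d0[of j] unfolding t_def T_eq
      by (intro mult_right_mono) (simp_all add: X_def)
    also have "\<dots> = \<epsilon> / 2 * a j" using Xp by (simp add: a_def)
    finally show "measure lebesgue (nbhd (fractions (T j)) (d j / real (X j))) \<le> \<epsilon> / 2 * a j" .
  qed
  also have "\<dots> = \<epsilon> / 2 * (\<Sum>j=j0..<n. a j)" by (simp add: sum_distrib_left)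
  also have "\<dots> \<le> \<epsilon> / 2 * 2" using n(3) \<epsilon> by (intro mult_left_mono) auto
  finally have mU: "measure lebesgue U \<le> \<epsilon>" by simp
  have dc: "d j \<le> c" if "j \<ge> j0" for j
  proof -
    have "n0 \<le> X (Suc j)" using Xj[of "Suc j"] that by (simp add: j0_def)
    then show ?thesis using n0 unfolding d_def by (intro min.coboundedI1 less_imp_le)
  qed
  have gnz: "q \<in> S \<and> X j0 \<le> q" if "g q \<noteq> 0" for q
    using that by (auto simp: g_def split: if_splits)
  have "block f \<epsilon> N c N' (d n) g U"
    unfolding block_def
  proof (intro conjI ballI impI mU NN' d0)
    show "d n \<le> c" using dc n(1) by simp
    show "U \<in> lmeasurable" unfolding U_def
      by (intro fmeasurable.finite_UN) (auto intro: nbhd_lmeasurable finite_fractions finT)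
  next
    fix q assume q: "q \<in> {N..<N'}"
    show "g q = 0 \<or> d n \<le> g q \<and> g q \<le> c"
    proof (cases "q \<in> S \<and> X j0 \<le> q")
      case True
      then have "J q \<in> {j0..<n}" using J q by simp
      then show ?thesis using True d_anti[of "J q" n] dc[of "J q"] by (simp add: g_def)
    qed (auto simp: g_def)
    show "g q \<le> f q"
    proof (cases "q \<in> S \<and> X j0 \<le> q")
      case True
      then have "q < X (Suc (J q))" using J(2)[of q] q by (auto simp: T_def)
      then have "f (X (Suc (J q))) \<le> f q" using q N by (intro f_anti) auto
      then show ?thesis using True by (simp add: g_def d_def min.coboundedI1)
    next
      case False
      then show ?thesis using f_pos[of q] q N by (auto simp: g_def)
    qed
    fix \<alpha> :: real assume \<alpha>: "\<alpha> \<in> {0..1}" and near: "nearest_int_dist (real q * \<alpha>) < g q"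
    have "g q \<noteq> 0" using near nearest_int_dist_nonneg[of "real q * \<alpha>"] by linarith
    then have qS: "q \<in> S" "X j0 \<le> q" using gnz by auto
    then have j: "J q \<in> {j0..<n}" "q \<in> T (J q)" using J q by auto
    have "\<alpha> \<in> nbhd (fractions (T (J q))) (d (J q) / real (X (J q)))"
    proof (rule near_fraction[OF \<alpha> j(2)])
      show "0 < real (X (J q))" using X1[of "J q"] by simp
      show "real (X (J q)) \<le> real q" using j(2) by (simp add: T_def)
      show "nearest_int_dist (real q * \<alpha>) < d (J q)" using near qS by (simp add: g_def)
    qed
    then show "\<alpha> \<in> U" using j(1) unfolding U_def by blast
  next
    show "antimono_on {q \<in> {N..<N'}. g q \<noteq> 0} g"
    proof (rule monotone_onI)
      fix q r assume q: "q \<in> {q \<in> {N..<N'}. g q \<noteq> 0}" and r: "r \<in> {q \<in> {N..<N'}. g q \<noteq> 0}" and "q \<le> r"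
      have qS: "q \<in> S" "X j0 \<le> q" "r \<in> S" "X j0 \<le> r" using gnz q r by auto
      have "r < X (Suc (J r))" using step_index_bounds[OF X X0[OF qS(4)]] by (simp add: J_def)
      then have "J q < Suc (J r)"
        using step_index_less_iff[OF X X0[OF qS(2)]] \<open>q \<le> r\<close> by (simp add: J_def)
      then show "g q \<ge> g r" using qS d_anti[of "J q" "J r"] by (simp add: g_def)
    qed
  qed
  moreover have "1 \<le> (\<Sum>q=N..<N'. g q)"
  proof -
    have "(\<Sum>j=j0..<n. a j) = (\<Sum>j=j0..<n. \<Sum>q\<in>T j. g q)"
      using gT by (intro sum.cong) (simp_all add: a_def t_def)
    also have "\<dots> = (\<Sum>q\<in>(\<Union>j\<in>{j0..<n}. T j). g q)"
      using finT disjT by (intro sum.UNION_disjoint[symmetric]) auto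
    also have "\<dots> \<le> (\<Sum>q=N..<N'. g q)"
      using gT d0 by (intro sum_mono2) (auto simp: g_def less_imp_le)
    finally show ?thesis using n(2) by simp
  qed
  ultimately show ?thesis by blast
qed

text \<open>
  A heavy block followed by a dense one whose values are smaller. The dense part is so long that
  the combined block has nearly full density at its end.
\<close>

lemma exists_heavy_dense_block:
  assumes f_pos: "\<And>q. q \<ge> 1 \<Longrightarrow> f q > 0"
    and f_anti: "\<And>p q. 1 \<le> p \<Longrightarrow> p \<le> q \<Longrightarrow> f q \<le> f p"
    and f_lim: "f \<longlonglongrightarrow> 0"
    and f_div: "\<not> summable f"
    and N: "N \<ge> 1" and c: "c > 0" and \<epsilon>: "\<epsilon> > 0"
  shows "\<exists>N' c' g U. block f \<epsilon> N c N' c' g U \<and> 1 \<le> (\<Sum>q=N..<N'. g q) \<and>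
           (1 - \<epsilon>) * real (N' - 1) \<le> real (card {q \<in> {N..<N'}. g q \<noteq> 0})"
proof -
  obtain N1 c1 g U where g: "block f (\<epsilon> / 2) N c N1 c1 g U" "1 \<le> (\<Sum>q=N..<N1. g q)"
    using exists_heavy_block[OF f_pos f_anti f_lim f_div N c, where \<epsilon> = "\<epsilon> / 2"] \<epsilon> by auto
  have N1: "N < N1" "1 \<le> N1" "0 < c1" using g N by (auto simp: block_def)
  obtain N2 c2 h V where h: "block f (\<epsilon> / 2) N1 c1 N2 c2 h V"
    "(1 - \<epsilon> / 2) * real (N2 - 1) \<le> real (card {q \<in> {N1..<N2}. h q \<noteq> 0})"
    using exists_dense_block[where f = f and \<epsilon> = "\<epsilon> / 2", OF f_pos f_anti N1(2,3)] \<epsilon> by auto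
  define k where "k q = (if q < N1 then g q else h q)" for q
  have b: "block f \<epsilon> N c N2 c2 k (U \<union> V)"
    using block_append[OF g(1) h(1)] by (simp add: k_def[abs_def])
  have k0: "0 \<le> k q" if "q \<in> {N..<N2}" for q
  proof -
    have "k q = 0 \<or> c2 \<le> k q" "0 < c2" using b that unfolding block_def by blast+
    then show ?thesis by linarith
  qed
  have N12: "N1 < N2" using h(1) by (simp add: block_def)
  have "(\<Sum>q=N..<N1. g q) = (\<Sum>q=N..<N1. k q)" by (simp add: k_def)
  also have "\<dots> \<le> (\<Sum>q=N..<N2. k q)" using k0 N12 by (intro sum_mono2) auto
  finally have "1 \<le> (\<Sum>q=N..<N2. k q)" using g(2) by simp
  moreover have "(1 - \<epsilon>) * real (N2 - 1) \<le> real (card {q \<in> {N..<N2}. k q \<noteq> 0})"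
  proof -
    have "(1 - \<epsilon>) * real (N2 - 1) \<le> (1 - \<epsilon> / 2) * real (N2 - 1)"
      using \<epsilon> by (intro mult_right_mono) auto
    also note h(2)
    also have "card {q \<in> {N1..<N2}. h q \<noteq> 0} \<le> card {q \<in> {N..<N2}. k q \<noteq> 0}"
      using N1 by (intro card_mono) (auto simp: k_def)
    finally show ?thesis by simp
  qed
  ultimately show ?thesis using b by blast
qed

section \<open>Concatenation of the blocks\<close>

lemma not_summable_of_sum_diverges:
  assumes "sum_diverges f"
  shows "\<not> summable f"
proof
  assume "summable f"
  then have "summable (\<lambda>n. f (Suc n))" by (simp add: summable_Suc_iff)
  then have "(\<lambda>N. \<Sum>n<N. f (Suc n)) \<longlonglongrightarrow> (\<Sum>n. f (Suc n))" by (rule summable_LIMSEQ)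
  moreover have "(\<Sum>n<N. f (Suc n)) = (\<Sum>q=1..N. f q)" for N
    by (rule sum.reindex_bij_witness[of _ "\<lambda>q. q - 1" Suc]) auto
  ultimately have "(\<lambda>N. \<Sum>q=1..N. f q) \<longlonglongrightarrow> (\<Sum>n. f (Suc n))" by simp
  with assms show False
    unfolding sum_diverges_def using not_tendsto_and_filterlim_at_infinity[OF sequentially_bot]
      filterlim_at_top_imp_at_infinity by blast
qed

theorem theorem1p3:
  fixes f :: "nat \<Rightarrow> real"
  assumes f_nonneg: "\<And>q. q \<ge> 1 \<Longrightarrow> f q \<ge> 0"
    and f_antimono: "antimono_on {1..} f"
    and f_lim: "f \<longlonglongrightarrow> 0"
    and f_diverges: "sum_diverges f"
  shows "\<exists>\<psi> :: nat \<Rightarrow> real.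
           (\<forall>q\<ge>1. \<psi> q \<ge> 0) \<and>
           antimono_on (supp \<psi>) \<psi> \<and>
           (\<forall>q\<ge>1. \<psi> q \<le> f q) \<and>
           sum_diverges \<psi> \<and>
           W \<psi> \<in> null_sets lebesgue \<and>
           upper_density (supp \<psi>) = 1"
proof -
  have f_anti: "f q \<le> f p" if "1 \<le> p" "p \<le> q" for p q
    using f_antimono that by (auto simp: monotone_on_def)
  have f_div: "\<not> summable f" using f_diverges by (rule not_summable_of_sum_diverges)
  have f_pos: "f q > 0" if q: "q \<ge> 1" for q
  proof (rule ccontr)
    assume "\<not> f q > 0"
    then have "f r = 0" if "r \<ge> q" for r
      using f_anti[OF q that] f_nonneg[of r] that q by simp
    then have "summable f" by (intro summable_finite[of "{..<q}"]) (auto simp: not_less)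
    with f_div show False ..
  qed
  \<comment> \<open>A state consists of the next free integer, the upper bound for later values, and the block and cover that led to it.\<close>
  define good where "good n = (\<lambda>(N, c, g :: nat \<Rightarrow> real, U :: real set) (N', c', g', U').
      block f ((1/2) ^ n) N c N' c' g' U' \<and> 1 \<le> (\<Sum>q=N..<N'. g' q) \<and>
      (1 - (1/2) ^ n) * real (N' - 1) \<le> real (card {q \<in> {N..<N'}. g' q \<noteq> 0}))" for n :: nat
  define ok where "ok n = (\<lambda>(N :: nat, c, g :: nat \<Rightarrow> real, U :: real set).
      1 \<le> N \<and> (0::real) < c \<and> (n = 0 \<longrightarrow> N = 1))" for n :: nat
  have "\<exists>z. \<forall>n. ok n (z n) \<and> good n (z n) (z (Suc n))"
  proof (rule dependent_nat_choice)
    show "\<exists>x. ok 0 x" by (intro exI[of _ "(1, 1, \<lambda>_. 0, {})"]) (simp add: ok_def)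
  next
    fix x n assume x: "ok n x"
    obtain N c g U where xe: "x = (N, c, g, U)" by (cases x)
    have "1 \<le> N" "0 < c" using x by (auto simp: ok_def xe)
    from exists_heavy_dense_block[where \<epsilon> = "(1/2) ^ n", OF f_pos f_anti f_lim f_div this]
    obtain N' c' g' U' where n: "good n x (N', c', g', U')" by (auto simp: good_def xe)
    then have "ok (Suc n) (N', c', g', U')"
      using \<open>1 \<le> N\<close> by (auto simp: ok_def good_def xe block_def)
    with n show "\<exists>y. ok (Suc n) y \<and> good n x y" by blast
  qed
  then obtain z where z: "\<And>n. ok n (z n)" "\<And>n. good n (z n) (z (Suc n))" by blast
  define X where "X n = fst (z n)" for n
  define c where "c n = fst (snd (z n))" for n
  define g where "g n = fst (snd (snd (z (Suc n))))" for n
  define U where "U n = snd (snd (snd (z (Suc n))))" for n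
  have blk: "block f ((1/2) ^ n) (X n) (c n) (X (Suc n)) (c (Suc n)) (g n) (U n)"
    and mass: "1 \<le> (\<Sum>q=X n..<X (Suc n). g n q)"
    and dens: "(1 - (1/2) ^ n) * real (X (Suc n) - 1) \<le> real (card {q \<in> {X n..<X (Suc n)}. g n q \<noteq> 0})" for n
    using z(2)[of n] by (auto simp: good_def X_def c_def g_def U_def split_beta)
  have X: "strict_mono X" using blk by (simp add: strict_mono_Suc_iff block_def)
  have X0: "X 0 = 1" using z(1)[of 0] by (auto simp: ok_def X_def split_beta)
  have X1: "1 \<le> X n" for n using z(1)[of n] by (auto simp: ok_def X_def split_beta)
  have c_anti: "c n \<le> c m" if "m \<le> n" for m n
    using that by (rule lift_Suc_antimono_le[rotated]) (use blk in \<open>simp add: block_def\<close>)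
  define J where "J = step_index X"
  define \<psi> where "\<psi> q = g (J q) q" for q
  have J: "X (J q) \<le> q" "q < X (Suc (J q))" if "q \<ge> 1" for q
    using step_index_bounds[OF X, of q] that by (simp_all add: X0 J_def)
  have J_eq: "\<psi> q = g n q" if "q \<in> {X n..<X (Suc n)}" for q n
    using step_index_eq[OF X, of n q] that by (simp add: \<psi>_def J_def)
  have J_ge: "J q \<ge> n" if "q \<ge> X n" for q n
    using step_index_less_iff[OF X, of q n] that X1[of n] X0 by (simp add: J_def not_less[symmetric])
  have J_mem: "q \<in> {X (J q)..<X (Suc (J q))}" if "q \<ge> 1" for q using J[OF that] by simp
  have range: "\<psi> q = 0 \<or> c (Suc (J q)) \<le> \<psi> q \<and> \<psi> q \<le> c (J q)" if "q \<ge> 1" for q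
    using blk[of "J q"] J_mem[OF that] unfolding block_def \<psi>_def by blast
  have c_pos: "c n > 0" for n using z(1)[of n] by (auto simp: ok_def c_def split_beta)
  have nonneg: "\<psi> q \<ge> 0" if "q \<ge> 1" for q
    using range[OF that] c_pos[of "Suc (J q)"] by linarith
  have le_f: "\<psi> q \<le> f q" if "q \<ge> 1" for q
    using blk[of "J q"] J_mem[OF that] unfolding block_def \<psi>_def by blast
  have anti: "antimono_on (supp \<psi>) \<psi>"
  proof (rule monotone_onI)
    fix p q assume p: "p \<in> supp \<psi>" and q: "q \<in> supp \<psi>" and pq: "p \<le> q"
    have p1: "p \<ge> 1" "\<psi> p \<noteq> 0" and q1: "q \<ge> 1" "\<psi> q \<noteq> 0" using p q by (auto simp: supp_def)
    have "X (J p) \<le> q" using J(1)[OF p1(1)] pq by linarith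
    then have "J p \<le> J q" by (rule J_ge)
    then consider "J p = J q" | "Suc (J p) \<le> J q" by linarith
    then show "\<psi> p \<ge> \<psi> q"
    proof cases
      case 1
      have "antimono_on {r \<in> {X (J q)..<X (Suc (J q))}. g (J q) r \<noteq> 0} (g (J q))" 
        using blk[of "J q"] unfolding block_def by blast
      then have "g (J q) q \<le> g (J q) p"
        by (rule monotone_onD) (use p1 q1 J_mem[of p] J_mem[of q] 1 pq in \<open>auto simp: \<psi>_def\<close>)
      then show ?thesis using 1 by (simp add: \<psi>_def)
    next
      case 2
      then have "c (J q) \<le> c (Suc (J p))" by (rule c_anti)
      then show ?thesis using range[OF p1(1)] range[OF q1(1)] p1(2) q1(2) by linarith
    qed
  qed
  have div: "sum_diverges \<psi>"
  proof -
    \<comment> \<open>Each of the first \<open>n\<close> blocks has mass at least \<open>1\<close>.\<close>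
    have part: "real n \<le> (\<Sum>q=1..<X n. \<psi> q)" for n
    proof (induction n)
      case (Suc n)
      have "X n \<le> X (Suc n)" using X by (simp add: strict_mono_less_eq)
      then have "(\<Sum>q=1..<X (Suc n). \<psi> q) = (\<Sum>q=1..<X n. \<psi> q) + (\<Sum>q=X n..<X (Suc n). \<psi> q)"
        using X1[of n] by (simp add: sum.atLeastLessThan_concat)
      also have "(\<Sum>q=X n..<X (Suc n). \<psi> q) = (\<Sum>q=X n..<X (Suc n). g n q)"
        by (intro sum.cong J_eq) auto
      finally show ?case using Suc mass[of n] by simp
    qed (simp add: X0)
    show ?thesis unfolding sum_diverges_def filterlim_at_top
    proof
      fix Z :: real
      obtain n :: nat where n: "Z \<le> real n" using real_arch_simple by blast
      have "Z \<le> (\<Sum>q=1..N. \<psi> q)" if "N \<ge> X n" for N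
      proof -
        have "(\<Sum>q=1..<X n. \<psi> q) \<le> (\<Sum>q=1..N. \<psi> q)"
          using that nonneg by (intro sum_mono2) auto
        then show ?thesis using n part[of n] by linarith
      qed
      then show "eventually (\<lambda>N. Z \<le> (\<Sum>q=1..N. \<psi> q)) sequentially"
        by (auto simp: eventually_at_top_linorder)
    qed
  qed
  have null: "W \<psi> \<in> null_sets lebesgue"
  proof -
    have Um: "U n \<in> lmeasurable" "measure lebesgue (U n) \<le> (1/2) ^ n" for n
      using blk[of n] by (auto simp: block_def)
    have "summable (\<lambda>n. measure lebesgue (U n))"
      by (rule summable_comparison_test'[of "\<lambda>n. (1/2) ^ n" 0]) (use Um in \<open>auto simp: summable_geometric\<close>)
    then have "limsup U \<in> null_sets lebesgue"
      using fmeasurableD[OF Um(1)] fmeasurableD2[OF Um(1)]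
      by (intro borel_cantelli_limsup1) (simp_all add: less_top)
    moreover have "W \<psi> \<subseteq> limsup U"
    proof
      fix \<alpha> assume \<alpha>: "\<alpha> \<in> W \<psi>"
      show "\<alpha> \<in> limsup U"
        unfolding mem_limsup_iff frequently_sequentially
      proof
        fix n
        obtain q where q: "q \<ge> X n" "q \<ge> 1" "nearest_int_dist (real q * \<alpha>) < \<psi> q"
          using \<alpha> unfolding W_def infinite_nat_iff_unbounded_le by blast
        have "\<alpha> \<in> U (J q)"
          using blk[of "J q"] J_mem[OF q(2)] q(3) \<alpha> unfolding block_def \<psi>_def W_def by blast
        then show "\<exists>m\<ge>n. \<alpha> \<in> U m" using J_ge[OF q(1)] by blast
      qed
    qed
    ultimately show ?thesis
      unfolding negligible_iff_null_sets[symmetric] by (rule negligible_subset)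
  qed
  have density: "upper_density (supp \<psi>) = 1"
  proof -
    define u where "u N = real (card (supp \<psi> \<inter> {1..N})) / real N" for N
    have "card (supp \<psi> \<inter> {1..N}) \<le> card {1..N}" for N by (intro card_mono) auto
    then have "u N \<le> 1" for N by (auto simp: u_def divide_le_eq_1)
    then have upper: "limsup (\<lambda>N. ereal (u N)) \<le> 1"
      by (intro Limsup_bounded always_eventually) (simp add: one_ereal_def)
    \<comment> \<open>The last integers of the blocks form a subsequence along which the density tends to \<open>1\<close>.\<close>
    define r where "r n = X (Suc n) - 1" for n
    have r: "strict_mono r"
      unfolding strict_mono_Suc_iff r_def using X1 X by (simp add: diff_less_mono strict_mono_less)
    have rpos: "r n > 0" for n
      using strict_monoD[OF X, of n "Suc n"] X1[of n] by (simp add: r_def)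
    have lower: "1 - (1/2) ^ n \<le> u (r n)" for n
    proof -
      have "{q \<in> {X n..<X (Suc n)}. g n q \<noteq> 0} \<subseteq> supp \<psi> \<inter> {1..r n}"
        using J_eq[of _ n] X1[of n] by (auto simp: supp_def r_def)
      then have "card {q \<in> {X n..<X (Suc n)}. g n q \<noteq> 0} \<le> card (supp \<psi> \<inter> {1..r n})"
        by (intro card_mono) auto
      then have "(1 - (1/2) ^ n) * real (r n) \<le> real (card (supp \<psi> \<inter> {1..r n}))"
        using dens[of n] by (simp add: r_def)
      then show ?thesis using rpos[of n] by (simp add: u_def pos_le_divide_eq)
    qed
    have "(\<lambda>n. ereal (1 - (1/2) ^ n)) \<longlonglongrightarrow> ereal (1 - 0)"
      by (intro tendsto_intros LIMSEQ_power_zero) auto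
    then have "1 = limsup (\<lambda>n. ereal (1 - (1/2) ^ n))"
      by (subst lim_imp_Limsup) (auto simp: one_ereal_def)
    also have "\<dots> \<le> limsup ((\<lambda>N. ereal (u N)) \<circ> r)"
      using lower by (intro Limsup_mono always_eventually) simp
    also have "\<dots> \<le> limsup (\<lambda>N. ereal (u N))" by (rule limsup_subseq_mono[OF r])
    finally show ?thesis using upper by (simp add: upper_density_def u_def)
  qed
  show ?thesis using nonneg anti le_f div null density by blast
qed

end
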